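(* Fix $s,t>0$ with $s>t/2$. For $N\in\mathbb{N}$ let $U^N_t$ be a random unitary matrix with law $\rho^N_t$ and $Z^N_{s,t}$ a random invertible matrix with law $\mu^N_{s,t}$, all defined on a single probability space. Let $(\mathscr{A},\tau)$ be a noncommutative probability space containing the almost sure weak limits $u_t$ and $z_{s,t}$ of $U^N_t$ and $Z^N_{s,t}$. Then, for any noncommutative polynomial $f\in\mathbb{C}\langle A,A^*\rangle$ and any even integer $p\ge2$, as $N\to\infty$, $$\|f(U^N_t,(U^N_t)^* )\|_{L^p(\mathbb{M}_N,\mathrm{tr})}\to\|f(u_t,u_t^* )\|_{L^p(\mathscr{A},\tau)}\quad\text{a.s.},$$ $$\|f(Z^N_{s,t},(Z^N_{s,t})^* )\|_{L^p(\mathbb{M}_N,\mathrm{tr})}\to\|f(z_{s,t},z_{s,t}^* )\|_{L^p(\mathscr{A},\tau)}\quad\text{a.s.}$$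
   Context: $\mathrm{tr}=\frac1N\mathrm{Tr}$ on $\mathbb{M}_N$. $\mathfrak{u}_N=\{X\in\mathbb{M}_N:X^*=-X\}$ carries the inner product $\langle X,Y\rangle_N=-N\,\mathrm{Tr}(XY)$, with orthonormal basis $\beta_N$. For $\xi\in\mathbb{M}_N$, $(\partial_\xi f)(g)=\frac{d}{du}\big|_{u=0}f(ge^{u\xi})$. $\Delta_{\mathbb{U}_N}=\sum_{X\in\beta_N}\partial_X^2$ on $C^\infty(\mathbb{U}_N)$, and $A^N_{s,t}=(s-\frac t2)\sum_{X\in\beta_N}\partial_X^2+\frac t2\sum_{X\in\beta_N}\partial_{iX}^2$ on $C^\infty(\mathbb{GL}_N)$. $\rho^N_t$ is the unique probability measure on the unitary group $\mathbb{U}_N$ with $\int f\,d\rho^N_t=(e^{\frac t2\Delta_{\mathbb{U}_N}}f)(I_N)$ for $f\in C(\mathbb{U}_N)$; $\mu^N_{s,t}$ is the unique probability measure on $\mathbb{GL}_N$ with $\int f\,d\mu^N_{s,t}=(e^{\frac12A^N_{s,t}}f)(I_N)$ for $f\in C_c(\mathbb{GL}_N)$. $\mathbb{C}\langle A,A^*\rangle$ is the algebra of noncommutative polynomials in two variables $A,A^*$. A noncommutative probability space $(\mathscr{A},\tau)$ is a unital complex $*$-algebra with a unital, tracial, positive semidefinite linear functional $\tau$. That $u_t\in\mathscr{A}$ is the almost sure weak limit of $U^N_t$ means that for all $g\in\mathbb{C}\langle A,A^*\rangle$, $\mathrm{tr}[g(U^N_t,(U^N_t)^* )]\to\tau[g(u_t,u_t^*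 )]$ almost surely as $N\to\infty$; similarly for $z_{s,t}$ and $Z^N_{s,t}$ (these limits exist). For even $p$, $\|a\|_{L^p(\mathscr{A},\tau)}=\big(\tau[(aa^* )^{p/2}]\big)^{1/p}$, and likewise for $(\mathbb{M}_N,\mathrm{tr})$. *)

theory Defs
  imports
    "HOL-Probability.Probability"
    "HOL-Library.Poly_Mapping"
    "Jordan_Normal_Form.Schur_Decomposition"
begin

section \<open>Complex matrices of size \<open>N\<close>\<close>

definition cmat_topology :: "nat \<Rightarrow> complex mat topology" where
  "cmat_topology N = pullback_topology (carrier_mat N N)
     (\<lambda>A. \<lambda>ij\<in>{..<N} \<times> {..<N}. A $$ ij)
     (product_topology (\<lambda>_. euclidean) ({..<N} \<times> {..<N}))"

definition cmat_borel :: "nat \<Rightarrow> complex mat set \<Rightarrow> complex mat measure" where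
  "cmat_borel N G = sigma G {V. openin (subtopology (cmat_topology N) G) V}"

definition mat_trace :: "complex mat \<Rightarrow> complex" where
  "mat_trace A = (\<Sum>i<dim_row A. A $$ (i, i))"

definition ntr :: "nat \<Rightarrow> complex mat \<Rightarrow> complex" where
  "ntr N A = mat_trace A / of_nat N"

definition mat_exp :: "nat \<Rightarrow> complex mat \<Rightarrow> complex mat" where
  "mat_exp N A = Matrix.mat N N (\<lambda>(i, j). suminf (\<lambda>k. (A ^\<^sub>m k) $$ (i, j) / fact k))"

definition unitary_group :: "nat \<Rightarrow> complex mat set" where
  "unitary_group N = {A \<in> carrier_mat N N.
     A * mat_adjoint A = 1\<^sub>m N \<and> mat_adjoint A * A = 1\<^sub>m N}"

definition gl_group :: "nat \<Rightarrow> complex mat set" where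
  "gl_group N = {A \<in> carrier_mat N N. invertible_mat A}"

definition u_algebra :: "nat \<Rightarrow> complex mat set" where
  "u_algebra N = {X \<in> carrier_mat N N. mat_adjoint X = - X}"

definition u_inner :: "nat \<Rightarrow> complex mat \<Rightarrow> complex mat \<Rightarrow> complex" where
  "u_inner N X Y = - of_nat N * mat_trace (X * Y)"

text \<open>A basis over the real numbers; the inner product \<^const>\<open>u_inner\<close> takes real values on
  \<^const>\<open>u_algebra\<close>.\<close>

definition u_orthonormal_basis :: "nat \<Rightarrow> complex mat set \<Rightarrow> bool" where
  "u_orthonormal_basis N \<beta> \<longleftrightarrow>
     finite \<beta> \<and> \<beta> \<subseteq> u_algebra N \<and>
     (\<forall>X\<in>\<beta>. \<forall>Y\<in>\<beta>. u_inner N X Y = (if X = Y then 1 else 0)) \<and>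
     (\<forall>X\<in>u_algebra N. \<exists>c :: complex mat \<Rightarrow> real.
        X = Matrix.mat N N (\<lambda>(i, j). \<Sum>Y\<in>\<beta>. of_real (c Y) * Y $$ (i, j)))"


section \<open>Function spaces on a matrix group\<close>

text \<open>Functions on \<open>G\<close> are represented by functions on all of \<^typ>\<open>complex mat\<close>; only the values
  on \<open>G\<close> matter in everything that follows.\<close>

definition cont_fun :: "nat \<Rightarrow> complex mat set \<Rightarrow> (complex mat \<Rightarrow> complex) \<Rightarrow> bool" where
  "cont_fun N G f \<longleftrightarrow> continuous_map (subtopology (cmat_topology N) G) euclidean f"

definition compact_supp :: "nat \<Rightarrow> complex mat set \<Rightarrow> (complex mat \<Rightarrow> complex) \<Rightarrow> bool" where
  "compact_supp N G f \<longleftrightarrow>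
     (\<exists>K. K \<subseteq> G \<and> compactin (cmat_topology N) K \<and> (\<forall>g\<in>G - K. f g = 0))"

text \<open>The space \<open>C\<^sub>0(G)\<close>, which is all of \<open>C(G)\<close> when \<open>G\<close> is compact.\<close>

definition C0_fun :: "nat \<Rightarrow> complex mat set \<Rightarrow> (complex mat \<Rightarrow> complex) \<Rightarrow> bool" where
  "C0_fun N G f \<longleftrightarrow> cont_fun N G f \<and>
     (\<forall>\<epsilon>>0. \<exists>K. K \<subseteq> G \<and> compactin (cmat_topology N) K \<and> (\<forall>g\<in>G - K. norm (f g) < \<epsilon>))"

text \<open>\<open>Ck_open N k V f\<close>: on the open set \<open>V\<close>, all iterated (real) directional derivatives of \<open>f\<close>
  of order at most \<open>k\<close>, in all directions of the real vector space of \<open>N \<times> N\<close> complex matrices,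
  exist and are continuous.\<close>

primrec Ck_open :: "nat \<Rightarrow> nat \<Rightarrow> complex mat set \<Rightarrow> (complex mat \<Rightarrow> complex) \<Rightarrow> bool" where
  "Ck_open N 0 V f \<longleftrightarrow> cont_fun N V f"
| "Ck_open N (Suc k) V f \<longleftrightarrow> cont_fun N V f \<and>
     (\<forall>H\<in>carrier_mat N N.
        (\<forall>A\<in>V. (\<lambda>u::real. f (A + complex_of_real u \<cdot>\<^sub>m H)) differentiable (at 0)) \<and>
        Ck_open N k V (\<lambda>A. vector_derivative (\<lambda>u::real. f (A + complex_of_real u \<cdot>\<^sub>m H)) (at 0)))"

text \<open>\<open>C\<^sup>\<infinity>(G)\<close> for an embedded submanifold \<open>G\<close> of the space of matrices: local extendability to
  a smooth function on an open set of matrices.\<close>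

definition smooth_fun :: "nat \<Rightarrow> complex mat set \<Rightarrow> (complex mat \<Rightarrow> complex) \<Rightarrow> bool" where
  "smooth_fun N G f \<longleftrightarrow>
     (\<forall>g\<in>G. \<exists>V F. openin (cmat_topology N) V \<and> g \<in> V \<and> (\<forall>k. Ck_open N k V F) \<and>
        (\<forall>h\<in>V \<inter> G. F h = f h))"


section \<open>Invariant differential operators and the semigroups they generate\<close>

definition lie_deriv :: "nat \<Rightarrow> complex mat \<Rightarrow> (complex mat \<Rightarrow> complex) \<Rightarrow> complex mat \<Rightarrow> complex" where
  "lie_deriv N \<xi> f g = vector_derivative (\<lambda>u::real. f (g * mat_exp N (complex_of_real u \<cdot>\<^sub>m \<xi>))) (at 0)"

definition laplacian_U ::
  "nat \<Rightarrow> complex mat set \<Rightarrow> (complex mat \<Rightarrow> complex) \<Rightarrow> complex mat \<Rightarrow> complex" where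
  "laplacian_U N \<beta> f g = (\<Sum>X\<in>\<beta>. lie_deriv N X (lie_deriv N X f) g)"

definition operator_GL ::
  "nat \<Rightarrow> complex mat set \<Rightarrow> real \<Rightarrow> real \<Rightarrow> (complex mat \<Rightarrow> complex) \<Rightarrow> complex mat \<Rightarrow> complex" where
  "operator_GL N \<beta> s t f g =
     of_real (s - t / 2) * (\<Sum>X\<in>\<beta>. lie_deriv N X (lie_deriv N X f) g) +
     of_real (t / 2) * (\<Sum>X\<in>\<beta>. lie_deriv N (\<i> \<cdot>\<^sub>m X) (lie_deriv N (\<i> \<cdot>\<^sub>m X) f) g)"

text \<open>\<open>T\<close> is a strongly continuous semigroup of bounded operators on the Banach space \<open>C\<^sub>0(G)\<close>
  (with the supremum norm) whose generator is the closure of the operator \<open>L\<close> with domain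
  \<open>C\<^sub>c\<^sup>\<infinity>(G)\<close> (which is \<open>C\<^sup>\<infinity>(G)\<close> when \<open>G\<close> is compact).  A semigroup is determined by its
  generator, so there is at most one such \<open>T\<close>, up to the values \<open>T r f g\<close> with \<open>r < 0\<close>,
  \<open>f \<notin> C\<^sub>0(G)\<close> or \<open>g \<notin> G\<close>.\<close>

definition generates_semigroup ::
  "nat \<Rightarrow> complex mat set \<Rightarrow> ((complex mat \<Rightarrow> complex) \<Rightarrow> complex mat \<Rightarrow> complex) \<Rightarrow>
   (real \<Rightarrow> (complex mat \<Rightarrow> complex) \<Rightarrow> complex mat \<Rightarrow> complex) \<Rightarrow> bool" where
  "generates_semigroup N G L T \<longleftrightarrow>
     (\<forall>r\<ge>0. \<forall>f. C0_fun N G f \<longrightarrow> C0_fun N G (T r f)) \<and>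
     (\<forall>r\<ge>0. \<forall>f h a b. C0_fun N G f \<longrightarrow> C0_fun N G h \<longrightarrow>
        (\<forall>g\<in>G. T r (\<lambda>x. a * f x + b * h x) g = a * T r f g + b * T r h g)) \<and>
     (\<forall>r\<ge>0. \<exists>M. \<forall>f B. C0_fun N G f \<longrightarrow> (\<forall>g\<in>G. norm (f g) \<le> B) \<longrightarrow>
        (\<forall>g\<in>G. norm (T r f g) \<le> M * B)) \<and>
     (\<forall>f. C0_fun N G f \<longrightarrow> (\<forall>g\<in>G. T 0 f g = f g)) \<and>
     (\<forall>q\<ge>0. \<forall>r\<ge>0. \<forall>f. C0_fun N G f \<longrightarrow> (\<forall>g\<in>G. T (q + r) f g = T q (T r f) g)) \<and>
     (\<forall>f. C0_fun N G f \<longrightarrow> uniform_limit G (\<lambda>r. T r f) f (at_right 0)) \<and>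
     (\<forall>f h. C0_fun N G f \<longrightarrow> C0_fun N G h \<longrightarrow>
        (uniform_limit G (\<lambda>r g. (T r f g - f g) / of_real r) h (at_right 0) \<longleftrightarrow>
         (\<exists>F :: nat \<Rightarrow> complex mat \<Rightarrow> complex.
            (\<forall>n. smooth_fun N G (F n) \<and> compact_supp N G (F n)) \<and>
            uniform_limit G F f sequentially \<and>
            uniform_limit G (\<lambda>n. L (F n)) h sequentially)))"

text \<open>The value of \<open>e\<^bsup>rL\<^esup> f\<close> at \<open>g \<in> G\<close>, for \<open>r \<ge> 0\<close> and \<open>f \<in> C\<^sub>0(G)\<close>.\<close>

definition exp_operator ::
  "nat \<Rightarrow> complex mat set \<Rightarrow> ((complex mat \<Rightarrow> complex) \<Rightarrow> complex mat \<Rightarrow> complex) \<Rightarrow>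
   real \<Rightarrow> (complex mat \<Rightarrow> complex) \<Rightarrow> complex mat \<Rightarrow> complex" where
  "exp_operator N G L r f g = (THE z. \<exists>T. generates_semigroup N G L T \<and> z = T r f g)"

definition rho :: "nat \<Rightarrow> complex mat set \<Rightarrow> real \<Rightarrow> complex mat measure" where
  "rho N \<beta> t = (THE M. sets M = sets (cmat_borel N (unitary_group N)) \<and> prob_space M \<and>
     (\<forall>f. cont_fun N (unitary_group N) f \<longrightarrow>
        integral\<^sup>L M f = exp_operator N (unitary_group N) (laplacian_U N \<beta>) (t / 2) f (1\<^sub>m N)))"

definition mu :: "nat \<Rightarrow> complex mat set \<Rightarrow> real \<Rightarrow> real \<Rightarrow> complex mat measure" where
  "mu N \<beta> s t = (THE M. sets M = sets (cmat_borel N (gl_group N)) \<and> prob_space M \<and>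
     (\<forall>f. cont_fun N (gl_group N) f \<and> compact_supp N (gl_group N) f \<longrightarrow>
        integral\<^sup>L M f = exp_operator N (gl_group N) (operator_GL N \<beta> s t) (1 / 2) f (1\<^sub>m N)))"


section \<open>Noncommutative polynomials\<close>

datatype nc_var = VA | VAstar

datatype nc_word = Word (letters: "nc_var list")

instantiation nc_word :: monoid_add
begin

definition zero_nc_word :: nc_word where "0 = Word []"

definition plus_nc_word :: "nc_word \<Rightarrow> nc_word \<Rightarrow> nc_word" where
  "v + w = Word (letters v @ letters w)"

instance
  by standard (simp_all add: zero_nc_word_def plus_nc_word_def)

end

text \<open>The monoid algebra over the complex numbers of the free monoid on two letters, which is
  written additively because the multiplication of \<^type>\<open>poly_mapping\<close> is the convolution
  product for \<open>+\<close> on the index type.\<close>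

type_synonym nc_poly = "nc_word \<Rightarrow>\<^sub>0 complex"

definition eval_mat :: "nat \<Rightarrow> nc_poly \<Rightarrow> complex mat \<Rightarrow> complex mat \<Rightarrow> complex mat" where
  "eval_mat N f X Y = Matrix.mat N N (\<lambda>ij. \<Sum>w\<in>Poly_Mapping.keys f. Poly_Mapping.lookup f w *
     foldr (\<lambda>v M. (case v of VA \<Rightarrow> X | VAstar \<Rightarrow> Y) * M) (letters w) (1\<^sub>m N) $$ ij)"

definition eval_alg ::
  "(complex \<Rightarrow> 'a::ring_1 \<Rightarrow> 'a) \<Rightarrow> nc_poly \<Rightarrow> 'a \<Rightarrow> 'a \<Rightarrow> 'a" where
  "eval_alg scaleC f x y = (\<Sum>w\<in>Poly_Mapping.keys f. scaleC (Poly_Mapping.lookup f w)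
     (prod_list (map (\<lambda>v. case v of VA \<Rightarrow> x | VAstar \<Rightarrow> y) (letters w))))"


section \<open>Noncommutative probability spaces\<close>

text \<open>The \<open>*\<close>-algebra is carried by the whole type.\<close>

locale nc_prob_space = vector_space scaleC
  for scaleC :: "complex \<Rightarrow> 'a::ring_1 \<Rightarrow> 'a" +
  fixes star :: "'a \<Rightarrow> 'a" and tau :: "'a \<Rightarrow> complex"
  assumes scaleC_mult_left: "scaleC c x * y = scaleC c (x * y)"
    and scaleC_mult_right: "x * scaleC c y = scaleC c (x * y)"
    and star_add: "star (x + y) = star x + star y"
    and star_scaleC: "star (scaleC c x) = scaleC (cnj c) (star x)"
    and star_mult: "star (x * y) = star y * star x"
    and star_star: "star (star x) = x"
    and tau_linear: "Vector_Spaces.linear scaleC (*) tau"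
    and tau_one: "tau 1 = 1"
    and tau_tracial: "tau (x * y) = tau (y * x)"
    and tau_positive: "tau (x * star x) \<in> \<real>\<^sub>\<ge>\<^sub>0"

text \<open>The \<open>L\<^sup>p\<close> norms below are meant for even \<open>p \<ge> 2\<close>; then the argument of
  \<^const>\<open>Re\<close> is a nonnegative real number.\<close>

definition Lp_norm_alg :: "('a::ring_1 \<Rightarrow> 'a) \<Rightarrow> ('a \<Rightarrow> complex) \<Rightarrow> nat \<Rightarrow> 'a \<Rightarrow> real" where
  "Lp_norm_alg star tau p a = root p (Re (tau ((a * star a) ^ (p div 2))))"

definition Lp_norm_mat :: "nat \<Rightarrow> nat \<Rightarrow> complex mat \<Rightarrow> real" where
  "Lp_norm_mat N p X = root p (Re (ntr N ((X * mat_adjoint X) ^\<^sub>m (p div 2))))"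

definition as_weak_limit ::
  "'w measure \<Rightarrow> (nat \<Rightarrow> 'w \<Rightarrow> complex mat) \<Rightarrow>
   (complex \<Rightarrow> 'a::ring_1 \<Rightarrow> 'a) \<Rightarrow> ('a \<Rightarrow> 'a) \<Rightarrow> ('a \<Rightarrow> complex) \<Rightarrow> 'a \<Rightarrow> bool" where
  "as_weak_limit P X scaleC star tau x \<longleftrightarrow>
     (\<forall>g :: nc_poly. AE \<omega> in P.
        (\<lambda>N. ntr N (eval_mat N g (X N \<omega>) (mat_adjoint (X N \<omega>))))
          \<longlonglongrightarrow> tau (eval_alg scaleC g x (star x)))"

end

theory Submission
  imports Defs
begin

text \<open>For even \<open>p\<close>, the \<open>p\<close>-th power of the \<open>L\<^sup>p\<close> norm of a noncommutative polynomial is itself the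
  trace of a noncommutative polynomial, and almost sure weak convergence is convergence of exactly
  such traces. Write \<open>f\<^sup>*\<close> for the adjoint of \<open>f\<close> in the \<open>*\<close>-algebra of noncommutative polynomials,
  where \<open>A\<close> and \<open>A\<^sup>*\<close> are exchanged, and put \<open>g = (f f\<^sup>*)\<^bsup>p/2\<^esup>\<close>. Evaluation at a pair \<open>(x, x\<^sup>*)\<close> is a
  homomorphism of \<open>*\<close>-algebras, both for matrices (lemmas \<open>eval_mat_mult\<close>, \<open>eval_mat_nc_adjoint\<close>)
  and in a noncommutative probability space (lemmas \<open>eval_alg_mult\<close>, \<open>eval_alg_nc_adjoint\<close>), so the
  \<open>p\<close>-th powers of the two \<open>L\<^sup>p\<close> norms are the traces of the evaluations of \<open>g\<close>. The definition of the
  weak limit, applied to \<open>g\<close>, and continuity of the \<open>p\<close>-th root give the claim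
  (\<open>as_weak_limit_imp_Lp_norm_tendsto\<close>).\<close>

section \<open>Linear extension of a function on monomials\<close>

text \<open>The linear map on the monoid algebra that takes the value \<open>\<phi> w\<close> at the monomial \<open>w\<close>.\<close>

definition lin_ext :: "(complex \<Rightarrow> 'b \<Rightarrow> 'b) \<Rightarrow> ('m \<Rightarrow> 'b) \<Rightarrow> ('m \<Rightarrow>\<^sub>0 complex) \<Rightarrow> 'b::ab_group_add" where
  "lin_ext sc \<phi> f = (\<Sum>w\<in>Poly_Mapping.keys f. sc (Poly_Mapping.lookup f w) (\<phi> w))"

lemma poly_mapping_sum_single:
  "(\<Sum>w\<in>Poly_Mapping.keys f. Poly_Mapping.single w (Poly_Mapping.lookup f w)) = f"
  by (rule poly_mapping_eqI)
     (auto simp: lookup_sum lookup_single when_def in_keys_iff sum.delta')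

lemma lin_ext_superset:
  assumes "vector_space sc" "finite S" "Poly_Mapping.keys f \<subseteq> S"
  shows "lin_ext sc \<phi> f = (\<Sum>w\<in>S. sc (Poly_Mapping.lookup f w) (\<phi> w))"
proof -
  interpret vector_space sc by fact
  show ?thesis
    unfolding lin_ext_def
    by (rule sum.mono_neutral_left) (use assms in \<open>auto simp: in_keys_iff\<close>)
qed

lemma lin_ext_add:
  assumes "vector_space sc"
  shows "lin_ext sc \<phi> (f + g) = lin_ext sc \<phi> f + lin_ext sc \<phi> g"
proof -
  interpret vector_space sc by fact
  let ?S = "Poly_Mapping.keys f \<union> Poly_Mapping.keys g"
  have "lin_ext sc \<phi> h = (\<Sum>w\<in>?S. sc (Poly_Mapping.lookup h w) (\<phi> w))" if "h \<in> {f, g, f + g}" for h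
    using assms by (rule lin_ext_superset) (use that keys_add[of f g] in auto)
  then show ?thesis
    by (simp add: lookup_add scale_left_distrib sum.distrib)
qed

lemma lin_ext_single:
  assumes "vector_space sc"
  shows "lin_ext sc \<phi> (Poly_Mapping.single w c) = sc c (\<phi> w)"
proof -
  have "lin_ext sc \<phi> (Poly_Mapping.single w c) =
      (\<Sum>v\<in>{w}. sc (Poly_Mapping.lookup (Poly_Mapping.single w c) v) (\<phi> v))"
    using assms by (rule lin_ext_superset) auto
  then show ?thesis by simp
qed

lemma lin_ext_one:
  assumes "vector_space sc"
  shows "lin_ext sc \<phi> (1 :: 'm::zero \<Rightarrow>\<^sub>0 complex) = \<phi> 0"
proof -
  interpret vector_space sc by fact
  show ?thesis using lin_ext_single[OF assms, of \<phi> 0 1] by simp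
qed

lemma lin_ext_sum:
  assumes "vector_space sc"
  shows "lin_ext sc \<phi> (\<Sum>i\<in>I. F i) = (\<Sum>i\<in>I. lin_ext sc \<phi> (F i))"
proof (induction I rule: infinite_finite_induct)
  case (insert i I)
  then show ?case by (simp add: lin_ext_add[OF assms])
qed (simp_all add: lin_ext_def)

lemma lin_ext_mult:
  assumes "vector_space sc"
  shows "lin_ext sc \<phi> (f * g) =
    (\<Sum>v\<in>Poly_Mapping.keys f. \<Sum>w\<in>Poly_Mapping.keys g.
       sc (Poly_Mapping.lookup f v * Poly_Mapping.lookup g w) (\<phi> (v + w)))"
proof -
  have "f * g = (\<Sum>v\<in>Poly_Mapping.keys f. \<Sum>w\<in>Poly_Mapping.keys g.
      Poly_Mapping.single v (Poly_Mapping.lookup f v) * Poly_Mapping.single w (Poly_Mapping.lookup g w))"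
    by (simp only: sum_product[symmetric] poly_mapping_sum_single)
  then show ?thesis
    by (simp add: mult_single lin_ext_sum[OF assms] lin_ext_single[OF assms])
qed

lemma vector_space_complex: "vector_space ((*) :: complex \<Rightarrow> complex \<Rightarrow> complex)"
  by unfold_locales (simp_all add: algebra_simps)


section \<open>The adjoint of a noncommutative polynomial\<close>

fun var_star :: "nc_var \<Rightarrow> nc_var" where
  "var_star VA = VAstar"
| "var_star VAstar = VA"

text \<open>The adjoint of a monomial: the reversed word, with \<open>A\<close> and \<open>A\<^sup>*\<close> exchanged.\<close>

definition word_star :: "nc_word \<Rightarrow> nc_word" where
  "word_star w = Word (rev (map var_star (letters w)))"

text \<open>The conjugate-linear extension of \<^const>\<open>word_star\<close>.\<close>

definition nc_adjoint :: "nc_poly \<Rightarrow> nc_poly" where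
  "nc_adjoint f = (\<Sum>w\<in>Poly_Mapping.keys f.
     Poly_Mapping.single (word_star w) (cnj (Poly_Mapping.lookup f w)))"

lemma lin_ext_nc_adjoint:
  assumes "vector_space sc"
  shows "lin_ext sc \<phi> (nc_adjoint f) =
    (\<Sum>w\<in>Poly_Mapping.keys f. sc (cnj (Poly_Mapping.lookup f w)) (\<phi> (word_star w)))"
  by (simp add: nc_adjoint_def lin_ext_sum[OF assms] lin_ext_single[OF assms])


section \<open>Evaluation at matrices\<close>

lemma mat_adjoint_carrier: "A \<in> carrier_mat n m \<Longrightarrow> mat_adjoint A \<in> carrier_mat m n"
  by (auto simp: mat_adjoint_def)

lemma mat_adjoint_index:
  assumes "A \<in> carrier_mat n m" "i < m" "j < n"
  shows "mat_adjoint A $$ (i, j) = cnj (A $$ (j, i))"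
  using assms by (simp add: mat_adjoint_def mat_of_rows_index)

lemma mat_adjoint_mat_adjoint:
  fixes A :: "complex mat"
  assumes "A \<in> carrier_mat n m"
  shows "mat_adjoint (mat_adjoint A) = A"
  by (rule eq_matI)
     (use assms mat_adjoint_carrier[OF assms] mat_adjoint_carrier[OF mat_adjoint_carrier[OF assms]]
       in \<open>auto simp: mat_adjoint_index[OF assms] mat_adjoint_index[OF mat_adjoint_carrier[OF assms]]\<close>)

lemma mat_adjoint_one: "mat_adjoint (1\<^sub>m n) = (1\<^sub>m n :: complex mat)"
  by (rule eq_matI)
     (use mat_adjoint_carrier[OF one_carrier_mat[of n]] in
       \<open>auto simp: mat_adjoint_index[OF one_carrier_mat]\<close>)

lemma mat_adjoint_mult:
  fixes A B :: "complex mat"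
  assumes A: "A \<in> carrier_mat n m" and B: "B \<in> carrier_mat m l"
  shows "mat_adjoint (A * B) = mat_adjoint B * mat_adjoint A"
proof (rule eq_matI)
  note adj = mat_adjoint_carrier[OF A] mat_adjoint_carrier[OF B]
  fix i j assume "i < dim_row (mat_adjoint B * mat_adjoint A)"
    and "j < dim_col (mat_adjoint B * mat_adjoint A)"
  then have ij: "i < l" "j < n" using adj by auto
  have "mat_adjoint (A * B) $$ (i, j) = cnj ((A * B) $$ (j, i))"
    using A B ij by (intro mat_adjoint_index[of _ n l]) auto
  also have "\<dots> = (mat_adjoint B * mat_adjoint A) $$ (i, j)"
    using A B adj ij
    by (simp add: scalar_prod_def mat_adjoint_index[OF A] mat_adjoint_index[OF B] mult.commute)
  finally show "mat_adjoint (A * B) $$ (i, j) = (mat_adjoint B * mat_adjoint A) $$ (i, j)" .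
qed (use mat_adjoint_carrier[OF A] mat_adjoint_carrier[OF B]
       mat_adjoint_carrier[OF mult_carrier_mat[OF A B]] in auto)

text \<open>The value of a word at a pair of matrices, in the form in which it occurs in
  \<^const>\<open>eval_mat\<close>.\<close>

definition word_mat :: "nat \<Rightarrow> complex mat \<Rightarrow> complex mat \<Rightarrow> nc_var list \<Rightarrow> complex mat" where
  "word_mat N X Y = (\<lambda>vs. foldr (\<lambda>v M. (case v of VA \<Rightarrow> X | VAstar \<Rightarrow> Y) * M) vs (1\<^sub>m N))"

lemma word_mat_Nil [simp]: "word_mat N X Y [] = 1\<^sub>m N"
  and word_mat_Cons [simp]:
    "word_mat N X Y (v # vs) = (case v of VA \<Rightarrow> X | VAstar \<Rightarrow> Y) * word_mat N X Y vs"
  by (simp_all add: word_mat_def)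

lemma word_mat_carrier:
  assumes "X \<in> carrier_mat N N" "Y \<in> carrier_mat N N"
  shows "word_mat N X Y vs \<in> carrier_mat N N"
  using assms by (induction vs) (auto split: nc_var.split)

lemma word_mat_append:
  assumes X: "X \<in> carrier_mat N N" and Y: "Y \<in> carrier_mat N N"
  shows "word_mat N X Y (vs @ ws) = word_mat N X Y vs * word_mat N X Y ws"
proof (induction vs)
  case Nil
  show ?case using word_mat_carrier[OF X Y, of ws] by simp
next
  case (Cons v vs)
  have "(case v of VA \<Rightarrow> X | VAstar \<Rightarrow> Y) \<in> carrier_mat N N"
    using X Y by (simp split: nc_var.split)
  then show ?case
    using Cons assoc_mult_mat[OF _ word_mat_carrier[OF X Y] word_mat_carrier[OF X Y]] by simp
qed

lemma word_mat_adjoint: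
  assumes X: "X \<in> carrier_mat N N"
  shows "word_mat N X (mat_adjoint X) (rev (map var_star vs)) =
    mat_adjoint (word_mat N X (mat_adjoint X) vs)"
proof (induction vs)
  case Nil
  show ?case by (simp add: mat_adjoint_one)
next
  case (Cons v vs)
  note X' = mat_adjoint_carrier[OF X]
  let ?V = "case v of VA \<Rightarrow> X | VAstar \<Rightarrow> mat_adjoint X"
  have V: "?V \<in> carrier_mat N N" using X X' by (simp split: nc_var.split)
  have "word_mat N X (mat_adjoint X) [var_star v] = mat_adjoint ?V"
    using X X' mat_adjoint_mat_adjoint[OF X] by (cases v) auto
  then show ?case
    using Cons mat_adjoint_mult[OF V word_mat_carrier[OF X X']]
    by (simp add: word_mat_append[OF X X'])
qed

lemma eval_mat_carrier: "eval_mat N f X Y \<in> carrier_mat N N"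
  by (simp add: eval_mat_def)

lemma dim_eval_mat [simp]:
  "dim_row (eval_mat N f X Y) = N" "dim_col (eval_mat N f X Y) = N"
  by (simp_all add: eval_mat_def)

lemma eval_mat_index:
  assumes "i < N" "j < N"
  shows "eval_mat N f X Y $$ (i, j) = lin_ext (*) (\<lambda>w. word_mat N X Y (letters w) $$ (i, j)) f"
  using assms by (simp add: eval_mat_def lin_ext_def word_mat_def)

lemma eval_mat_one: "eval_mat N 1 X Y = 1\<^sub>m N"
proof (rule eq_matI)
  fix i j assume "i < dim_row (1\<^sub>m N)" "j < dim_col (1\<^sub>m N)"
  then show "eval_mat N 1 X Y $$ (i, j) = 1\<^sub>m N $$ (i, j)"
    by (simp add: eval_mat_index lin_ext_one[OF vector_space_complex] zero_nc_word_def)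
qed simp_all

lemma eval_mat_mult:
  assumes X: "X \<in> carrier_mat N N" and Y: "Y \<in> carrier_mat N N"
  shows "eval_mat N (f * g) X Y = eval_mat N f X Y * eval_mat N g X Y"
proof (rule eq_matI)
  note C = eval_mat_carrier[of N f X Y] eval_mat_carrier[of N g X Y]
  let ?W = "\<lambda>w. word_mat N X Y (letters w)"
  let ?F = "Poly_Mapping.lookup f" and ?G = "Poly_Mapping.lookup g"
  let ?Kf = "Poly_Mapping.keys f" and ?Kg = "Poly_Mapping.keys g"
  fix i j assume "i < dim_row (eval_mat N f X Y * eval_mat N g X Y)"
    "j < dim_col (eval_mat N f X Y * eval_mat N g X Y)"
  then have ij: "i < N" "j < N" using C by auto
  have W: "?W (v + w) $$ (i, j) = (\<Sum>k<N. ?W v $$ (i, k) * ?W w $$ (k, j))" for v w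
    using word_mat_carrier[OF X Y, of "letters v"] word_mat_carrier[OF X Y, of "letters w"] ij
    by (simp add: plus_nc_word_def word_mat_append[OF X Y] scalar_prod_def lessThan_atLeast0)
  have "eval_mat N (f * g) X Y $$ (i, j) =
      (\<Sum>v\<in>?Kf. \<Sum>w\<in>?Kg. \<Sum>k<N. (?F v * ?W v $$ (i, k)) * (?G w * ?W w $$ (k, j)))"
    using ij by (simp add: eval_mat_index lin_ext_mult[OF vector_space_complex] W
        sum_distrib_left mult.assoc mult.left_commute)
  also have "\<dots> = (\<Sum>v\<in>?Kf. \<Sum>k<N. \<Sum>w\<in>?Kg. (?F v * ?W v $$ (i, k)) * (?G w * ?W w $$ (k, j)))"
    by (intro sum.cong refl sum.swap)
  also have "\<dots> = (\<Sum>k<N. \<Sum>v\<in>?Kf. \<Sum>w\<in>?Kg. (?F v * ?W v $$ (i, k)) * (?G w * ?W w $$ (k, j)))"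
    by (rule sum.swap)
  also have "\<dots> = (\<Sum>k<N. eval_mat N f X Y $$ (i, k) * eval_mat N g X Y $$ (k, j))"
    using ij by (simp add: eval_mat_index lin_ext_def sum_product)
  also have "\<dots> = (eval_mat N f X Y * eval_mat N g X Y) $$ (i, j)"
    using C ij by (simp add: scalar_prod_def lessThan_atLeast0)
  finally show "eval_mat N (f * g) X Y $$ (i, j) = (eval_mat N f X Y * eval_mat N g X Y) $$ (i, j)" .
qed simp_all

lemma eval_mat_power:
  assumes "X \<in> carrier_mat N N" and "Y \<in> carrier_mat N N"
  shows "eval_mat N (f ^ k) X Y = eval_mat N f X Y ^\<^sub>m k"
proof (induction k)
  case 0
  show ?case using eval_mat_carrier[of N f X Y] by (simp add: eval_mat_one)
next
  case (Suc k)
  then show ?case by (simp add: power_Suc2 eval_mat_mult[OF assms] del: power_Suc)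
qed

lemma eval_mat_nc_adjoint:
  assumes X: "X \<in> carrier_mat N N"
  shows "eval_mat N (nc_adjoint f) X (mat_adjoint X) = mat_adjoint (eval_mat N f X (mat_adjoint X))"
proof (rule eq_matI)
  note C = eval_mat_carrier[of N f X "mat_adjoint X"]
  note X' = mat_adjoint_carrier[OF X]
  fix i j assume "i < dim_row (mat_adjoint (eval_mat N f X (mat_adjoint X)))"
    "j < dim_col (mat_adjoint (eval_mat N f X (mat_adjoint X)))"
  then have ij: "i < N" "j < N" using mat_adjoint_carrier[OF C] by auto
  then show "eval_mat N (nc_adjoint f) X (mat_adjoint X) $$ (i, j) =
      mat_adjoint (eval_mat N f X (mat_adjoint X)) $$ (i, j)"
    by (simp add: mat_adjoint_index[OF C] eval_mat_index lin_ext_nc_adjoint[OF vector_space_complex]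
        word_star_def word_mat_adjoint[OF X] mat_adjoint_index[OF word_mat_carrier[OF X X']])
       (simp add: lin_ext_def)
qed (use mat_adjoint_carrier[OF eval_mat_carrier[of N f X "mat_adjoint X"]] in auto)


section \<open>Evaluation in a noncommutative probability space\<close>

text \<open>The value of a word at a pair of ring elements, in the form in which it occurs in
  \<^const>\<open>eval_alg\<close>.\<close>

definition word_alg :: "'a::monoid_mult \<Rightarrow> 'a \<Rightarrow> nc_var list \<Rightarrow> 'a" where
  "word_alg x y vs = prod_list (map (\<lambda>v. case v of VA \<Rightarrow> x | VAstar \<Rightarrow> y) vs)"

lemma eval_alg_lin_ext: "eval_alg sc f x y = lin_ext sc (\<lambda>w. word_alg x y (letters w)) f"
  by (simp add: eval_alg_def lin_ext_def word_alg_def)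

context nc_prob_space
begin

lemma eval_alg_one: "eval_alg scaleC 1 x y = 1"
  by (simp add: eval_alg_lin_ext lin_ext_one[OF vector_space_axioms] zero_nc_word_def word_alg_def)

lemma eval_alg_mult: "eval_alg scaleC (f * g) x y = eval_alg scaleC f x y * eval_alg scaleC g x y"
  unfolding eval_alg_lin_ext lin_ext_mult[OF vector_space_axioms]
  by (simp add: lin_ext_def sum_product scaleC_mult_left scaleC_mult_right word_alg_def
        plus_nc_word_def mult.commute[of "Poly_Mapping.lookup f _"])

lemma eval_alg_power: "eval_alg scaleC (f ^ k) x y = eval_alg scaleC f x y ^ k"
  by (induction k) (simp_all add: eval_alg_one eval_alg_mult)

lemma star_zero: "star 0 = 0"
  using star_add[of 0 0] by simp

lemma star_one: "star 1 = 1"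
  using star_mult[of "star 1" 1] by (simp add: star_star)

lemma star_sum: "star (\<Sum>i\<in>I. F i) = (\<Sum>i\<in>I. star (F i))"
  by (induction I rule: infinite_finite_induct) (simp_all add: star_zero star_add)

lemma word_alg_adjoint:
  "word_alg x (star x) (rev (map var_star vs)) = star (word_alg x (star x) vs)"
proof (induction vs)
  case Nil
  show ?case by (simp add: word_alg_def star_one)
next
  case (Cons v vs)
  then show ?case by (cases v) (simp_all add: word_alg_def star_mult star_star)
qed

lemma eval_alg_nc_adjoint:
  "eval_alg scaleC (nc_adjoint f) x (star x) = star (eval_alg scaleC f x (star x))"
  unfolding eval_alg_lin_ext lin_ext_nc_adjoint[OF vector_space_axioms]
  by (simp add: word_star_def word_alg_adjoint lin_ext_def star_sum star_scaleC)

end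


section \<open>Convergence of the norms\<close>

text \<open>The polynomial whose trace is the \<open>p\<close>-th power of the \<open>L\<^sup>p\<close> norm of \<open>f\<close>, for even \<open>p\<close>.\<close>

definition norm_poly :: "nat \<Rightarrow> nc_poly \<Rightarrow> nc_poly" where
  "norm_poly p f = (f * nc_adjoint f) ^ (p div 2)"

lemma Lp_norm_mat_eval:
  assumes X: "X \<in> carrier_mat N N"
  shows "Lp_norm_mat N p (eval_mat N f X (mat_adjoint X)) =
    root p (Re (ntr N (eval_mat N (norm_poly p f) X (mat_adjoint X))))"
  using X mat_adjoint_carrier[OF X]
  by (simp add: Lp_norm_mat_def norm_poly_def eval_mat_power eval_mat_mult eval_mat_nc_adjoint)

lemma (in nc_prob_space) Lp_norm_alg_eval:
  "Lp_norm_alg star tau p (eval_alg scaleC f x (star x)) =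
    root p (Re (tau (eval_alg scaleC (norm_poly p f) x (star x))))"
  by (simp add: Lp_norm_alg_def norm_poly_def eval_alg_power eval_alg_mult eval_alg_nc_adjoint)

lemma (in nc_prob_space) as_weak_limit_imp_Lp_norm_tendsto:
  assumes X: "\<And>N \<omega>. N \<ge> 1 \<Longrightarrow> \<omega> \<in> space P \<Longrightarrow> X N \<omega> \<in> carrier_mat N N"
    and lim: "as_weak_limit P X scaleC star tau x"
  shows "AE \<omega> in P. (\<lambda>N. Lp_norm_mat N p (eval_mat N f (X N \<omega>) (mat_adjoint (X N \<omega>))))
    \<longlonglongrightarrow> Lp_norm_alg star tau p (eval_alg scaleC f x (star x))"
proof -
  have "AE \<omega> in P. (\<lambda>N. ntr N (eval_mat N (norm_poly p f) (X N \<omega>) (mat_adjoint (X N \<omega>))))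
      \<longlonglongrightarrow> tau (eval_alg scaleC (norm_poly p f) x (star x))"
    using lim by (simp add: as_weak_limit_def)
  then show ?thesis
  proof (rule AE_mp, intro AE_I2 impI)
    fix \<omega> assume \<omega>: "\<omega> \<in> space P"
    assume "(\<lambda>N. ntr N (eval_mat N (norm_poly p f) (X N \<omega>) (mat_adjoint (X N \<omega>))))
      \<longlonglongrightarrow> tau (eval_alg scaleC (norm_poly p f) x (star x))"
    then have "(\<lambda>N. root p (Re (ntr N (eval_mat N (norm_poly p f) (X N \<omega>) (mat_adjoint (X N \<omega>))))))
      \<longlonglongrightarrow> Lp_norm_alg star tau p (eval_alg scaleC f x (star x))"
      unfolding Lp_norm_alg_eval by (intro tendsto_real_root tendsto_Re)
    \<comment> \<open>For \<open>N = 0\<close> nothing is known about \<open>X N \<omega>\<close>, so the two sequences agree only eventually.\<close>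
    moreover have "\<forall>\<^sub>F N in sequentially.
        root p (Re (ntr N (eval_mat N (norm_poly p f) (X N \<omega>) (mat_adjoint (X N \<omega>))))) =
        Lp_norm_mat N p (eval_mat N f (X N \<omega>) (mat_adjoint (X N \<omega>)))"
      using eventually_ge_at_top[of 1]
      by eventually_elim (simp add: Lp_norm_mat_eval[OF X[OF _ \<omega>]])
    ultimately show "(\<lambda>N. Lp_norm_mat N p (eval_mat N f (X N \<omega>) (mat_adjoint (X N \<omega>))))
      \<longlonglongrightarrow> Lp_norm_alg star tau p (eval_alg scaleC f x (star x))"
      by (rule Lim_transform_eventually)
  qed
qed

lemma measurable_cmat_borel_carrier:
  assumes "X \<in> measurable P (cmat_borel N G)" "G \<subseteq> carrier_mat N N" "\<omega> \<in> space P"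
  shows "X \<omega> \<in> carrier_mat N N"
  using measurable_space[OF assms(1,3)] assms(2) by (auto simp: cmat_borel_def space_measure_of_conv)

theorem theorem1p8:
  fixes s t :: real
    and \<beta> :: "nat \<Rightarrow> complex mat set"
    and P :: "'w measure"
    and U Z :: "nat \<Rightarrow> 'w \<Rightarrow> complex mat"
    and scaleC :: "complex \<Rightarrow> 'a::ring_1 \<Rightarrow> 'a"
    and star :: "'a \<Rightarrow> 'a"
    and tau :: "'a \<Rightarrow> complex"
    and u z :: 'a
    and f :: nc_poly
    and p :: nat
  assumes "s > 0" and "t > 0" and "s > t / 2"
    and "\<And>N. N \<ge> 1 \<Longrightarrow> u_orthonormal_basis N (\<beta> N)"
    and "prob_space P"
    and "\<And>N. N \<ge> 1 \<Longrightarrow> U N \<in> measurable P (cmat_borel N (unitary_group N))"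
    and "\<And>N. N \<ge> 1 \<Longrightarrow> distr P (cmat_borel N (unitary_group N)) (U N) = rho N (\<beta> N) t"
    and "\<And>N. N \<ge> 1 \<Longrightarrow> Z N \<in> measurable P (cmat_borel N (gl_group N))"
    and "\<And>N. N \<ge> 1 \<Longrightarrow> distr P (cmat_borel N (gl_group N)) (Z N) = mu N (\<beta> N) s t"
    and "nc_prob_space scaleC star tau"
    and "as_weak_limit P U scaleC star tau u"
    and "as_weak_limit P Z scaleC star tau z"
    and "even p" and "p \<ge> 2"
  shows "(AE \<omega> in P.
            (\<lambda>N. Lp_norm_mat N p (eval_mat N f (U N \<omega>) (mat_adjoint (U N \<omega>))))
              \<longlonglongrightarrow> Lp_norm_alg star tau p (eval_alg scaleC f u (star u))) \<and>
         (AE \<omega> in P.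
            (\<lambda>N. Lp_norm_mat N p (eval_mat N f (Z N \<omega>) (mat_adjoint (Z N \<omega>))))
              \<longlonglongrightarrow> Lp_norm_alg star tau p (eval_alg scaleC f z (star z)))"
proof -
  interpret nc_prob_space scaleC star tau by fact
  have "U N \<omega> \<in> carrier_mat N N" if "N \<ge> 1" "\<omega> \<in> space P" for N \<omega>
    using assms(6)[OF that(1)] _ that(2)
    by (rule measurable_cmat_borel_carrier) (auto simp: unitary_group_def)
  moreover have "Z N \<omega> \<in> carrier_mat N N" if "N \<ge> 1" "\<omega> \<in> space P" for N \<omega>
    using assms(8)[OF that(1)] _ that(2)
    by (rule measurable_cmat_borel_carrier) (auto simp: gl_group_def)
  ultimately show ?thesis
    using assms(11,12) by (blast intro: as_weak_limit_imp_Lp_norm_tendsto)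
qed

end
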